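(* Let $d\ge 2$ and $r\ge 1$ be integers and let $H\leq\mathcal{N}_{d,r}$ be a finitely generated subgroup. If each element of $H$ induces an automorphism of some cofinite rooted subforest of $\mathcal{T}_{d,r}$ (possibly depending on the element), then $H$ entirely lies in the automorphism group of a cofinite rooted subforest of $\mathcal{T}_{d,r}$.
   Context: $\mathcal{T}_{d,r}$ is the rooted tree whose root has degree $r$ and all of whose other vertices have degree $d+1$ (i.e. $d$ children). A rooted subforest $F\subset\mathcal{T}_{d,r}$ is admissible if it is finite (possibly empty) and its root, if any, is the root of $\mathcal{T}_{d,r}$. The cofinite rooted subforest $F^C$ is obtained by deleting the vertices of $F$ and all edges with at least one endpoint in $F$; it is a rooted forest, with set of roots $\lambda(F^C)$ consisting of the children of vertices of $F$ that are not in $F$ (and the root of the tree if $F=\emptyset$). An almost automorphism is an equivalence class of triples $(\psi,F,F')$ with $F,F'$ admissible and $\psi\colon F^C\to F'^C$ a forest isomorphism sending $\lambda(F^C)$ bijectively onto $\lambda(F'^C)$; $(\psi_1,F_1,F_1')$ and $(\psi_2,F_2,F_2')$ are equivalent if there are admissible $F\supset F_1,F_2$ and $F'\supset F_1',F_2'$ such that $\psi_1,\psi_2$ induce the same rooted forest isomorphism $F^C\to F'^C$. The Neretin group $\mathcal{N}_{d,r}=\mathrm{AAut}(\mathcal{T}_{d,r})$ is the group of almost automorphisms. An element induces an automorphism of $F^C$ if it has a representative of the form $(\psi,F,F)$; the automorphism group of $F^C$, as a subgroup of $\mathcal{N}_{d,r}$, consists of all such elements. *)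

theory Defs
  imports "HOL-Algebra.Generated_Groups"
begin

text \<open>
  Vertices are addressed by words: \<open>[]\<close> is the root of the tree, and the children of \<open>v\<close> are
  the words \<open>v @ [i]\<close>, with \<open>i < r\<close> if \<open>v\<close> is the root and \<open>i < d\<close> otherwise.
\<close>

type_synonym vertex = "nat list"

definition tree :: "nat \<Rightarrow> nat \<Rightarrow> vertex set" where
  "tree d r = {v. \<forall>k < length v. v ! k < (if k = 0 then r else d)}"

definition child :: "vertex \<Rightarrow> vertex \<Rightarrow> bool" where
  "child u v \<longleftrightarrow> (\<exists>i. v = u @ [i])"

definition adjacent :: "vertex \<Rightarrow> vertex \<Rightarrow> bool" where
  "adjacent u v \<longleftrightarrow> child u v \<or> child v u"

text \<open>
  A set of vertices stands for the rooted subforest it induces; the roots of this forest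
  are the vertices that are not a child of another vertex of the forest.
\<close>

definition roots :: "vertex set \<Rightarrow> vertex set" where
  "roots X = {v \<in> X. \<not> (\<exists>u \<in> X. child u v)}"

definition admissible :: "nat \<Rightarrow> nat \<Rightarrow> vertex set \<Rightarrow> bool" where
  "admissible d r F \<longleftrightarrow> F \<subseteq> tree d r \<and> finite F \<and> roots F \<subseteq> {[]}"

definition cofinite_forest :: "nat \<Rightarrow> nat \<Rightarrow> vertex set \<Rightarrow> vertex set" where
  "cofinite_forest d r F = tree d r - F"

definition forest_iso :: "vertex set \<Rightarrow> vertex set \<Rightarrow> (vertex \<Rightarrow> vertex) \<Rightarrow> bool" where
  "forest_iso X Y \<psi> \<longleftrightarrow>
     bij_betw \<psi> X Y \<and>
     (\<forall>u \<in> X. \<forall>v \<in> X. adjacent u v \<longleftrightarrow> adjacent (\<psi> u) (\<psi> v)) \<and>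
     bij_betw \<psi> (roots X) (roots Y)"

type_synonym aaut_rep = "(vertex \<Rightarrow> vertex) \<times> vertex set \<times> vertex set"

definition aaut_reps :: "nat \<Rightarrow> nat \<Rightarrow> aaut_rep set" where
  "aaut_reps d r =
     {(\<psi>, F, F'). admissible d r F \<and> admissible d r F' \<and>
        forest_iso (cofinite_forest d r F) (cofinite_forest d r F') \<psi>}"

text \<open>
  The values of \<open>\<psi>\<close> outside the cofinite forest of \<open>F\<close> are irrelevant: representatives that
  differ only there are equivalent.
\<close>

definition aaut_rel :: "nat \<Rightarrow> nat \<Rightarrow> (aaut_rep \<times> aaut_rep) set" where
  "aaut_rel d r =
     {((\<psi>\<^sub>1, F\<^sub>1, F\<^sub>1'), (\<psi>\<^sub>2, F\<^sub>2, F\<^sub>2')).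
        (\<psi>\<^sub>1, F\<^sub>1, F\<^sub>1') \<in> aaut_reps d r \<and> (\<psi>\<^sub>2, F\<^sub>2, F\<^sub>2') \<in> aaut_reps d r \<and>
        (\<exists>F F'. admissible d r F \<and> admissible d r F' \<and>
           F\<^sub>1 \<union> F\<^sub>2 \<subseteq> F \<and> F\<^sub>1' \<union> F\<^sub>2' \<subseteq> F' \<and>
           forest_iso (cofinite_forest d r F) (cofinite_forest d r F') \<psi>\<^sub>1 \<and>
           forest_iso (cofinite_forest d r F) (cofinite_forest d r F') \<psi>\<^sub>2 \<and>
           (\<forall>v \<in> cofinite_forest d r F. \<psi>\<^sub>1 v = \<psi>\<^sub>2 v))}"

text \<open>
  The product of two classes is the class of the composite of any two composable
  representatives; \<open>mult_class\<close> below shows that this is well defined.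
\<close>

definition neretin :: "nat \<Rightarrow> nat \<Rightarrow> aaut_rep set monoid" where
  "neretin d r =
     \<lparr>carrier = aaut_reps d r // aaut_rel d r,
      mult = (\<lambda>g h. aaut_rel d r ``
        {(\<psi> \<circ> \<phi>, F, F'') |\<psi> \<phi> F F' F''. (\<psi>, F', F'') \<in> g \<and> (\<phi>, F, F') \<in> h}),
      one = aaut_rel d r `` {(id, {}, {})}\<rparr>"

definition induces_automorphism :: "aaut_rep set \<Rightarrow> vertex set \<Rightarrow> bool" where
  "induces_automorphism g F \<longleftrightarrow> (\<exists>\<psi>. (\<psi>, F, F) \<in> g)"

definition forest_automorphisms :: "nat \<Rightarrow> nat \<Rightarrow> vertex set \<Rightarrow> aaut_rep set set" where
  "forest_automorphisms d r F = {g \<in> carrier (neretin d r). induces_automorphism g F}"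

definition finitely_generated :: "('a, 'b) monoid_scheme \<Rightarrow> 'a set \<Rightarrow> bool" where
  "finitely_generated G H \<longleftrightarrow> (\<exists>S. finite S \<and> S \<subseteq> H \<and> generate G S = H)"

lemma child_unique: "child u v \<Longrightarrow> child w v \<Longrightarrow> u = w"
  by (auto simp: child_def)

lemma child_length: "child u v \<Longrightarrow> length v = Suc (length u)"
  by (auto simp: child_def)

lemma parent_in_tree: "v \<in> tree d r \<Longrightarrow> child u v \<Longrightarrow> u \<in> tree d r"
proof -
  assume v: "v \<in> tree d r" and c: "child u v"
  then obtain i where "v = u @ [i]" by (auto simp: child_def)
  then have "\<forall>k < length u. k < length v \<and> v ! k = u ! k"
    by (auto simp: nth_append)
  with v show "u \<in> tree d r" unfolding tree_def mem_Collect_eq by metis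
qed

lemma admissible_parent: "admissible d r F \<Longrightarrow> v \<in> F \<Longrightarrow> child u v \<Longrightarrow> u \<in> F"
  by (auto simp: admissible_def roots_def child_def)

lemma admissibleI:
  assumes "F \<subseteq> tree d r" "finite F" "\<And>u v. v \<in> F \<Longrightarrow> child u v \<Longrightarrow> u \<in> F"
  shows "admissible d r F"
proof -
  have "v = []" if "v \<in> roots F" for v
  proof (cases v rule: rev_cases)
    case (snoc u i)
    then have "child u v" by (auto simp: child_def)
    with that assms(3) show ?thesis by (auto simp: roots_def)
  qed
  with assms show ?thesis by (auto simp: admissible_def)
qed

lemma admissible_empty: "admissible d r {}"
  by (simp add: admissible_def roots_def)

lemma admissible_Un: "admissible d r F \<Longrightarrow> admissible d r G \<Longrightarrow> admissible d r (F \<union> G)"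
  by (rule admissibleI, simp add: admissible_def, simp add: admissible_def)
    (meson UnE UnI1 UnI2 admissible_parent)

lemma forest_iso_iff:
  "forest_iso X Y \<psi> \<longleftrightarrow>
     bij_betw \<psi> X Y \<and> (\<forall>u\<in>X. \<forall>v\<in>X. child u v \<longleftrightarrow> child (\<psi> u) (\<psi> v))"
proof (intro iffI conjI; (elim conjE)?)
  assume iso: "forest_iso X Y \<psi>"
  then show bij: "bij_betw \<psi> X Y" by (simp add: forest_iso_def)
  from iso have adj: "\<And>u v. u \<in> X \<Longrightarrow> v \<in> X \<Longrightarrow> adjacent u v \<longleftrightarrow> adjacent (\<psi> u) (\<psi> v)"
    and rt: "\<psi> ` roots X = roots Y"
    by (auto simp: forest_iso_def bij_betw_def)
  have inj: "\<And>u v. u \<in> X \<Longrightarrow> v \<in> X \<Longrightarrow> \<psi> u = \<psi> v \<Longrightarrow> u = v"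
    using bij by (auto simp: bij_betw_def inj_on_def)
  have mem: "\<And>u. u \<in> X \<Longrightarrow> \<psi> u \<in> Y" using bij by (auto simp: bij_betw_def)
  have fwd: "child (\<psi> u) (\<psi> v)" if "u \<in> X" "v \<in> X" "child u v" for u v
    using that
  proof (induction "length v" arbitrary: u v rule: less_induct)
    case less
    show ?case
    proof (rule ccontr)
      assume "\<not> ?thesis"
      with less.prems adj[of u v] have c: "child (\<psi> v) (\<psi> u)" by (auto simp: adjacent_def)
      then have "\<psi> u \<notin> roots Y" using mem less.prems by (auto simp: roots_def)
      then have "u \<notin> roots X" using rt by blast
      then obtain w where w: "w \<in> X" "child w u" using less.prems by (auto simp: roots_def)
      have "child (\<psi> w) (\<psi> u)"
        using less.hyps[of u w] less.prems w by (auto dest: child_length)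
      then have "w = v" using c child_unique inj less.prems w by metis
      then show False using w less.prems by (auto dest!: child_length)
    qed
  qed
  have "child u v" if "u \<in> X" "v \<in> X" "child (\<psi> u) (\<psi> v)" for u v
  proof (rule ccontr)
    assume "\<not> child u v"
    with that adj[of u v] have "child v u" by (auto simp: adjacent_def)
    then have "child (\<psi> v) (\<psi> u)" using fwd that by blast
    then show False using that by (auto dest!: child_length)
  qed
  with fwd show "\<forall>u\<in>X. \<forall>v\<in>X. child u v \<longleftrightarrow> child (\<psi> u) (\<psi> v)" by blast
next
  assume bij: "bij_betw \<psi> X Y"
    and ch: "\<forall>u\<in>X. \<forall>v\<in>X. child u v \<longleftrightarrow> child (\<psi> u) (\<psi> v)"
  have Y: "Y = \<psi> ` X" and inj: "inj_on \<psi> X" using bij by (auto simp: bij_betw_def)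
  have "\<psi> ` roots X = roots Y"
    unfolding Y using ch by (auto simp: roots_def)
  moreover have "inj_on \<psi> (roots X)" using inj by (rule inj_on_subset) (auto simp: roots_def)
  ultimately show "forest_iso X Y \<psi>"
    using bij ch by (auto simp: forest_iso_def adjacent_def bij_betw_def)
qed

lemma forest_iso_comp: "forest_iso X Y \<phi> \<Longrightarrow> forest_iso Y Z \<psi> \<Longrightarrow> forest_iso X Z (\<psi> \<circ> \<phi>)"
  unfolding forest_iso_iff by (auto intro: bij_betw_trans simp: bij_betw_apply)

lemma forest_iso_inv:
  assumes "forest_iso X Y \<psi>"
  shows "forest_iso Y X (inv_into X \<psi>)"
proof -
  have bij: "bij_betw \<psi> X Y"
    and ch: "\<And>u v. u \<in> X \<Longrightarrow> v \<in> X \<Longrightarrow> child u v \<longleftrightarrow> child (\<psi> u) (\<psi> v)"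
    using assms by (auto simp: forest_iso_iff)
  have "child u v \<longleftrightarrow> child (inv_into X \<psi> u) (inv_into X \<psi> v)" if "u \<in> Y" "v \<in> Y" for u v
  proof -
    have "inv_into X \<psi> u \<in> X" "inv_into X \<psi> v \<in> X"
      using bij that by (auto simp: bij_betw_def inv_into_into)
    then show ?thesis
      using ch bij that by (simp add: bij_betw_inv_into_right)
  qed
  then show ?thesis using bij_betw_inv_into[OF bij] by (simp add: forest_iso_iff)
qed

context
  fixes d r :: nat
begin

private abbreviation (input) "adm \<equiv> admissible d r"
private abbreviation (input) "cof \<equiv> cofinite_forest d r"
private abbreviation (input) "R \<equiv> aaut_rel d r"
private abbreviation (input) "reps \<equiv> aaut_reps d r"

lemma cof_mono: "F \<subseteq> G \<Longrightarrow> cof G \<subseteq> cof F"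
  by (auto simp: cofinite_forest_def)

lemma repD:
  assumes "(\<psi>, F, F') \<in> reps"
  shows "adm F" "adm F'" "forest_iso (cof F) (cof F') \<psi>"
  using assms by (auto simp: aaut_reps_def)

lemma rep_restrict:
  assumes rep: "(\<psi>, F, F') \<in> reps" and G: "adm G" "F \<subseteq> G"
  obtains G' where "F' \<subseteq> G'" "(\<psi>, G, G') \<in> reps"
proof
  note D = repD[OF rep]
  let ?G' = "F' \<union> \<psi> ` (G - F)"
  have bij: "bij_betw \<psi> (cof F) (cof F')"
    and ch: "\<And>u v. u \<in> cof F \<Longrightarrow> v \<in> cof F \<Longrightarrow> child u v \<longleftrightarrow> child (\<psi> u) (\<psi> v)"
    using D(3) by (auto simp: forest_iso_iff)
  have GF: "G - F \<subseteq> cof F" using G by (auto simp: cofinite_forest_def admissible_def)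
  have im: "\<psi> ` (G - F) \<subseteq> cof F'" using bij GF by (auto simp: bij_betw_def)
  have F'G': "cof ?G' = \<psi> ` cof G"
  proof -
    have "cof ?G' = cof F' - \<psi> ` (G - F)" by (auto simp: cofinite_forest_def)
    also have "\<dots> = \<psi> ` cof F - \<psi> ` (G - F)" using bij by (simp add: bij_betw_def)
    also have "\<dots> = \<psi> ` (cof F - (G - F))"
      using bij GF by (metis bij_betw_def inj_on_image_set_diff Diff_subset)
    also have "cof F - (G - F) = cof G" using G by (auto simp: cofinite_forest_def)
    finally show ?thesis .
  qed
  have adm': "adm ?G'"
  proof (rule admissibleI)
    show "?G' \<subseteq> tree d r" using D(2) im by (auto simp: admissible_def cofinite_forest_def)
    show "finite ?G'" using D(2) G by (auto simp: admissible_def)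
    fix u v assume v: "v \<in> ?G'" and c: "child u v"
    show "u \<in> ?G'"
    proof (cases "u \<in> F'")
      case False
      with v c D(2) have "v \<notin> F'" by (metis admissible_parent)
      with v obtain x where x: "x \<in> G - F" "v = \<psi> x" by blast
      then have "v \<in> cof F'" using im by auto
      then have "u \<in> cof F'" using c False by (auto simp: cofinite_forest_def dest: parent_in_tree)
      then obtain y where y: "y \<in> cof F" "u = \<psi> y" using bij by (auto simp: bij_betw_def)
      then have "child y x" using ch x c GF by auto
      then have "y \<in> G" using x G by (auto dest: admissible_parent)
      then show ?thesis using y by (auto simp: cofinite_forest_def)
    qed auto
  qed
  have "forest_iso (cof G) (cof ?G') \<psi>"
    unfolding F'G' forest_iso_iff
    using ch bij cof_mono[OF G(2)] by (auto simp: bij_betw_def intro: inj_on_subset)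
  then show "(\<psi>, G, ?G') \<in> reps" using adm' G by (auto simp: aaut_reps_def)
qed auto

lemma rep_inv: "(\<psi>, F, F') \<in> reps \<Longrightarrow> (inv_into (cof F) \<psi>, F', F) \<in> reps"
  by (auto simp: aaut_reps_def forest_iso_inv)

lemma rep_comp: "(\<psi>, F', F'') \<in> reps \<Longrightarrow> (\<phi>, F, F') \<in> reps \<Longrightarrow> (\<psi> \<circ> \<phi>, F, F'') \<in> reps"
  by (auto simp: aaut_reps_def intro: forest_iso_comp)

lemma rep_corestrict:
  assumes rep: "(\<psi>, F, F') \<in> reps" and G': "adm G'" "F' \<subseteq> G'"
  obtains G where "F \<subseteq> G" "(\<psi>, G, G') \<in> reps"
proof -
  obtain G where G: "F \<subseteq> G" "(inv_into (cof F) \<psi>, G', G) \<in> reps"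
    using rep_restrict[OF rep_inv[OF rep] G'] by blast
  obtain H where H: "F' \<subseteq> H" "(\<psi>, G, H) \<in> reps"
    using rep_restrict[OF rep _ G(1)] repD(2)[OF G(2)] by blast
  have bij: "bij_betw \<psi> (cof F) (cof F')"
    using repD(3)[OF rep] by (simp add: forest_iso_iff)
  have "cof H = \<psi> ` cof G"
    using repD(3)[OF H(2)] by (simp add: forest_iso_iff bij_betw_def)
  also have "\<dots> = \<psi> ` inv_into (cof F) \<psi> ` cof G'"
    using repD(3)[OF G(2)] by (simp add: forest_iso_iff bij_betw_def)
  also have "\<dots> = cof G'"
    using bij cof_mono[OF G'(2)] by (metis bij_betw_def image_inv_into_cancel)
  finally have "H = G'"
    using repD(2)[OF H(2)] G'(1) by (auto simp: cofinite_forest_def admissible_def)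
  with G H that show ?thesis by blast
qed

lemma rel_iff:
  "((\<psi>, F, F'), (\<phi>, E, E')) \<in> R \<longleftrightarrow>
     (\<psi>, F, F') \<in> reps \<and> (\<phi>, E, E') \<in> reps \<and>
     (\<exists>G. adm G \<and> F \<union> E \<subseteq> G \<and> (\<forall>v\<in>cof G. \<psi> v = \<phi> v))" (is "?L = ?R")
proof
  assume ?L then show ?R by (auto simp: aaut_rel_def)
next
  assume ?R
  then obtain G where rep: "(\<psi>, F, F') \<in> reps" "(\<phi>, E, E') \<in> reps"
    and G: "adm G" "F \<subseteq> G" "E \<subseteq> G" and eq: "\<And>v. v \<in> cof G \<Longrightarrow> \<psi> v = \<phi> v" by auto
  obtain G' where G': "F' \<subseteq> G'" "(\<psi>, G, G') \<in> reps" using rep_restrict[OF rep(1) G(1,2)] .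
  obtain H where H: "E' \<subseteq> H" "(\<phi>, G, H) \<in> reps" using rep_restrict[OF rep(2) G(1,3)] .
  have "cof G' = \<psi> ` cof G" "cof H = \<phi> ` cof G"
    using repD(3)[OF G'(2)] repD(3)[OF H(2)] by (auto simp: forest_iso_iff bij_betw_def)
  with eq have "cof G' = cof H" by auto
  then have "G' = H"
    using repD(2)[OF H(2)] repD(2)[OF G'(2)] by (auto simp: cofinite_forest_def admissible_def)
  then show ?L unfolding aaut_rel_def
    using rep G eq G'(1) H(1) repD[OF G'(2)] repD[OF H(2)] by blast
qed

lemma equiv_rel: "equiv reps R"
proof (rule equivI)
  show "R \<subseteq> reps \<times> reps" by (auto simp: aaut_rel_def)
  show "refl_on reps R"
  proof (rule refl_onI)
    fix t assume t: "t \<in> reps"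
    obtain \<psi> F F' where e: "t = (\<psi>, F, F')" by (metis prod_cases3)
    with t have "adm F" using repD(1) by blast
    with t show "(t, t) \<in> R" unfolding e rel_iff by blast
  qed
  show "sym R"
  proof (rule symI)
    fix s t assume st: "(s, t) \<in> R"
    obtain \<psi> F F' \<phi> E E' where e: "s = (\<psi>, F, F')" "t = (\<phi>, E, E')"
      by (metis prod_cases3)
    from st obtain G where G: "adm G" "F \<union> E \<subseteq> G" "\<forall>v\<in>cof G. \<psi> v = \<phi> v"
      by (auto simp: e rel_iff)
    then have "adm G \<and> E \<union> F \<subseteq> G \<and> (\<forall>v\<in>cof G. \<phi> v = \<psi> v)" by simp
    then show "(t, s) \<in> R" using st unfolding e rel_iff by blast
  qed
  show "trans R"
  proof (rule transI)
    fix s t u assume st: "(s, t) \<in> R" and tu: "(t, u) \<in> R"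
    obtain \<psi> F F' \<phi> E E' \<chi> D D' where stu: "s = (\<psi>, F, F')" "t = (\<phi>, E, E')" "u = (\<chi>, D, D')"
      by (metis prod_cases3)
    from st obtain G where G: "adm G" "F \<union> E \<subseteq> G" "\<forall>v\<in>cof G. \<psi> v = \<phi> v"
      by (auto simp: stu rel_iff)
    from tu obtain H where H: "adm H" "E \<union> D \<subseteq> H" "\<forall>v\<in>cof H. \<phi> v = \<chi> v"
      by (auto simp: stu rel_iff)
    have "adm (G \<union> H) \<and> F \<union> D \<subseteq> G \<union> H \<and> (\<forall>v\<in>cof (G \<union> H). \<psi> v = \<chi> v)"
      using G H by (auto simp: admissible_Un cofinite_forest_def)
    then show "(s, u) \<in> R" using st tu by (auto simp: stu rel_iff)
  qed
qed

lemma rel_restrict: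
  assumes "(\<psi>, F, F') \<in> reps" "(\<psi>, G, G') \<in> reps"
  shows "R `` {(\<psi>, F, F')} = R `` {(\<psi>, G, G')}"
  using assms admissible_Un[OF repD(1)[OF assms(1)] repD(1)[OF assms(2)]]
  by (intro equiv_class_eq[OF equiv_rel]) (auto simp: rel_iff)

lemma mult_class:
  assumes p: "(\<psi>, F', F'') \<in> reps" and q: "(\<phi>, F, F') \<in> reps"
  shows "R `` {(\<psi>, F', F'')} \<otimes>\<^bsub>neretin d r\<^esub> R `` {(\<phi>, F, F')} = R `` {(\<psi> \<circ> \<phi>, F, F'')}"
proof -
  have *: "((\<psi> \<circ> \<phi>, F, F''), (\<psi>1 \<circ> \<phi>1, E, E'')) \<in> R"
    if 1: "((\<psi>, F', F''), (\<psi>1, E', E'')) \<in> R" and 2: "((\<phi>, F, F'), (\<phi>1, E, E')) \<in> R"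
    for \<psi>1 \<phi>1 E E' E''
  proof -
    have r1: "(\<psi>1, E', E'') \<in> reps" "(\<phi>1, E, E') \<in> reps" using 1 2 by (auto simp: rel_iff)
    obtain G where G: "adm G" "F' \<union> E' \<subseteq> G" "\<forall>v\<in>cof G. \<psi> v = \<psi>1 v"
      using 1 by (auto simp: rel_iff)
    obtain H where H: "adm H" "F \<union> E \<subseteq> H" "\<forall>v\<in>cof H. \<phi> v = \<phi>1 v"
      using 2 by (auto simp: rel_iff)
    obtain K where K: "F \<subseteq> K" "(\<phi>, K, G) \<in> reps"
      using rep_corestrict[OF q G(1)] G(2) by auto
    have "\<phi> ` cof K = cof G"
      using repD(3)[OF K(2)] by (simp add: forest_iso_iff bij_betw_def)
    then have "\<forall>v\<in>cof (K \<union> H). (\<psi> \<circ> \<phi>) v = (\<psi>1 \<circ> \<phi>1) v"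
      using G(3) H(3) by (auto simp: cofinite_forest_def)
        (metis Diff_iff imageI)
    moreover have "adm (K \<union> H)" using K(2) H(1) by (auto intro: admissible_Un dest: repD)
    ultimately show ?thesis
      using rep_comp[OF p q] rep_comp[OF r1] H(2) K(1) by (auto simp: rel_iff)
  qed
  have "R `` {(\<psi>1 \<circ> \<phi>1, E, E'') |\<psi>1 \<phi>1 E E' E''.
      (\<psi>1, E', E'') \<in> R `` {(\<psi>, F', F'')} \<and> (\<phi>1, E, E') \<in> R `` {(\<phi>, F, F')}}
      = R `` {(\<psi> \<circ> \<phi>, F, F'')}" (is "R `` ?A = _")
  proof
    have "t \<in> R `` {(\<psi> \<circ> \<phi>, F, F'')}" if "s \<in> ?A" "(s, t) \<in> R" for s t
    proof -
      have "((\<psi> \<circ> \<phi>, F, F''), s) \<in> R" using that(1) * by blast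
      then show ?thesis using that(2) equiv_rel by (auto simp: equiv_def dest: transD)
    qed
    then show "R `` ?A \<subseteq> R `` {(\<psi> \<circ> \<phi>, F, F'')}" by blast
    have "(\<psi> \<circ> \<phi>, F, F'') \<in> ?A" using equiv_class_self[OF equiv_rel] p q by blast
    then show "R `` {(\<psi> \<circ> \<phi>, F, F'')} \<subseteq> R `` ?A" by blast
  qed
  then show ?thesis by (simp add: neretin_def)
qed

lemma class_in_carrier: "(\<psi>, F, F') \<in> reps \<Longrightarrow> R `` {(\<psi>, F, F')} \<in> carrier (neretin d r)"
  by (simp add: neretin_def quotientI)

lemma carrierE:
  assumes "g \<in> carrier (neretin d r)"
  obtains \<psi> F F' where "(\<psi>, F, F') \<in> reps" "g = R `` {(\<psi>, F, F')}"
proof -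
  from assms have "g \<in> reps // R" by (simp add: neretin_def)
  then obtain x where "x \<in> reps" "g = R `` {x}" by (rule quotientE)
  then show ?thesis using that by (cases x) blast
qed

lemma carrierE2:
  assumes "g \<in> carrier (neretin d r)" "h \<in> carrier (neretin d r)"
  obtains \<psi> \<phi> F F' F'' where "(\<psi>, F', F'') \<in> reps" "g = R `` {(\<psi>, F', F'')}"
    "(\<phi>, F, F') \<in> reps" "h = R `` {(\<phi>, F, F')}"
proof -
  obtain \<psi> A B where g: "(\<psi>, A, B) \<in> reps" "g = R `` {(\<psi>, A, B)}" using carrierE[OF assms(1)] .
  obtain \<phi> C D where h: "(\<phi>, C, D) \<in> reps" "h = R `` {(\<phi>, C, D)}" using carrierE[OF assms(2)] .
  have AD: "adm (A \<union> D)" using g h by (auto intro: admissible_Un dest: repD)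
  obtain B' where B': "(\<psi>, A \<union> D, B') \<in> reps" using rep_restrict[OF g(1) AD] by auto
  obtain C' where C': "(\<phi>, C', A \<union> D) \<in> reps" using rep_corestrict[OF h(1) AD] by auto
  show ?thesis
    using that[OF B' _ C'] g h rel_restrict[OF g(1) B'] rel_restrict[OF h(1) C'] by simp
qed

lemma rep_id: "adm F \<Longrightarrow> (id, F, F) \<in> reps"
  by (auto simp: aaut_reps_def forest_iso_iff)

lemma one_class: "adm F \<Longrightarrow> \<one>\<^bsub>neretin d r\<^esub> = R `` {(id, F, F)}"
  using rel_restrict[OF rep_id[OF admissible_empty] rep_id] by (simp add: neretin_def)

theorem neretin_group: "group (neretin d r)"
proof (rule groupI)
  show "\<one>\<^bsub>neretin d r\<^esub> \<in> carrier (neretin d r)"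
    unfolding one_class[OF admissible_empty]
    by (rule class_in_carrier[OF rep_id[OF admissible_empty]])
next
  fix g h assume gh: "g \<in> carrier (neretin d r)" "h \<in> carrier (neretin d r)"
  obtain \<psi> \<phi> F F' F'' where g: "(\<psi>, F', F'') \<in> reps" "g = R `` {(\<psi>, F', F'')}"
    and h: "(\<phi>, F, F') \<in> reps" "h = R `` {(\<phi>, F, F')}" using carrierE2[OF gh] .
  show "g \<otimes>\<^bsub>neretin d r\<^esub> h \<in> carrier (neretin d r)"
    unfolding g(2) h(2) mult_class[OF g(1) h(1)] by (rule class_in_carrier[OF rep_comp[OF g(1) h(1)]])
next
  fix g h k assume ghk: "g \<in> carrier (neretin d r)" "h \<in> carrier (neretin d r)"
    "k \<in> carrier (neretin d r)"
  obtain \<psi> \<phi> A B C where g: "(\<psi>, B, C) \<in> reps" "g = R `` {(\<psi>, B, C)}"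
    and h: "(\<phi>, A, B) \<in> reps" "h = R `` {(\<phi>, A, B)}" using carrierE2[OF ghk(1,2)] .
  obtain \<chi> D E where k: "(\<chi>, D, E) \<in> reps" "k = R `` {(\<chi>, D, E)}" using carrierE[OF ghk(3)] .
  have AE: "adm (A \<union> E)" using h k by (auto intro: admissible_Un dest: repD)
  obtain B' where B': "B \<subseteq> B'" "(\<phi>, A \<union> E, B') \<in> reps" using rep_restrict[OF h(1) AE] by auto
  obtain C' where C': "(\<psi>, B', C') \<in> reps"
    using rep_restrict[OF g(1) _ B'(1)] repD(2)[OF B'(2)] by blast
  obtain D' where D': "(\<chi>, D', A \<union> E) \<in> reps" using rep_corestrict[OF k(1) AE] by auto
  have "g = R `` {(\<psi>, B', C')}" "h = R `` {(\<phi>, A \<union> E, B')}" "k = R `` {(\<chi>, D', A \<union> E)}"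
    using g(2) h(2) k(2) rel_restrict[OF g(1) C'] rel_restrict[OF h(1) B'(2)]
      rel_restrict[OF k(1) D'] by simp_all
  then show "g \<otimes>\<^bsub>neretin d r\<^esub> h \<otimes>\<^bsub>neretin d r\<^esub> k = g \<otimes>\<^bsub>neretin d r\<^esub> (h \<otimes>\<^bsub>neretin d r\<^esub> k)"
    using mult_class[OF C' B'(2)] mult_class[OF B'(2) D']
      mult_class[OF rep_comp[OF C' B'(2)] D'] mult_class[OF C' rep_comp[OF B'(2) D']]
    by (simp add: comp_assoc)
next
  fix g assume "g \<in> carrier (neretin d r)"
  then obtain \<psi> F F' where g: "(\<psi>, F, F') \<in> reps" "g = R `` {(\<psi>, F, F')}" by (rule carrierE)
  have F: "adm F" "adm F'" using repD[OF g(1)] by auto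
  show "\<one>\<^bsub>neretin d r\<^esub> \<otimes>\<^bsub>neretin d r\<^esub> g = g"
    using mult_class[OF rep_id[OF F(2)] g(1)] one_class[OF F(2)] g(2) by simp
  let ?h = "inv_into (cof F) \<psi>"
  have h: "(?h, F', F) \<in> reps" using rep_inv[OF g(1)] .
  have "bij_betw \<psi> (cof F) (cof F')" using repD(3)[OF g(1)] by (simp add: forest_iso_iff)
  then have "((?h \<circ> \<psi>, F, F), (id, F, F)) \<in> R"
    using rep_comp[OF h g(1)] rep_id[OF F(1)] F(1)
    by (auto simp: rel_iff bij_betw_def intro!: exI[of _ F])
  then have "R `` {(?h \<circ> \<psi>, F, F)} = \<one>\<^bsub>neretin d r\<^esub>"
    using equiv_class_eq[OF equiv_rel] one_class[OF F(1)] by simp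
  then show "\<exists>y\<in>carrier (neretin d r). y \<otimes>\<^bsub>neretin d r\<^esub> g = \<one>\<^bsub>neretin d r\<^esub>"
    using mult_class[OF h g(1)] class_in_carrier[OF h] g(2) by metis
qed

end

end

theory Submission
  imports Defs
begin

text \<open>
  Choose \<open>F\<close> so large that representatives of all generators and of their inverses are defined
  outside of \<open>F\<close>, and let \<open>F'\<close> consist of the vertices from which a sequence of generators and
  inverses leads into \<open>F\<close>. Then \<open>F'\<close> is closed under parents and all generators preserve its
  complement, so that only the finiteness of \<open>F'\<close> is at stake. If \<open>F'\<close> were infinite, there would
  be such sequences starting from arbitrarily deep vertices; cutting off suffixes and applying
  the pigeonhole principle yields an element of \<open>H\<close> that maps the subtree below a vertex \<open>b @ w\<close>,
  with \<open>w \<noteq> []\<close>, onto the subtree below \<open>b\<close>. Such an element induces no automorphism of a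
  cofinite forest.
\<close>

section \<open>Words in the tree and finite subforests\<close>

lemma tree_appendD: "x @ w \<in> tree d r \<Longrightarrow> x \<in> tree d r"
proof (induction w rule: rev_induct)
  case (snoc i w)
  then show ?case using parent_in_tree[of "x @ w @ [i]" d r "x @ w"] by (auto simp: child_def)
qed simp

lemma tree_take: "x \<in> tree d r \<Longrightarrow> take n x \<in> tree d r"
  using tree_appendD[of "take n x" "drop n x"] by simp

lemma tree_append_zeros:
  assumes "d \<ge> 1" "r \<ge> 1" "x \<in> tree d r"
  shows "x @ replicate n 0 \<in> tree d r"
  using assms by (auto simp: tree_def nth_append)

lemma finite_tree_level: "finite {x \<in> tree d r. length x < n}"
proof (rule finite_subset)
  show "{x \<in> tree d r. length x < n} \<subseteq> {x. set x \<subseteq> {..<max d r} \<and> length x \<le> n}"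
    by (auto simp: tree_def in_set_conv_nth less_max_iff_disj split: if_splits)
qed (rule finite_lists_length_le, simp)

lemma admissible_appendD: "admissible d r F \<Longrightarrow> x @ w \<in> F \<Longrightarrow> x \<in> F"
proof (induction w rule: rev_induct)
  case (snoc i w)
  then show ?case
    using admissible_parent[of d r F "x @ w @ [i]" "x @ w"] by (auto simp: child_def)
qed simp

lemma admissible_UN:
  "finite S \<Longrightarrow> (\<And>s. s \<in> S \<Longrightarrow> admissible d r (f s)) \<Longrightarrow> admissible d r (\<Union>s\<in>S. f s)"
  by (induction rule: finite_induct) (simp_all add: admissible_empty admissible_Un)

lemma cof_append:
  "admissible d r F \<Longrightarrow> x \<in> cofinite_forest d r F \<Longrightarrow> x @ w \<in> tree d r
    \<Longrightarrow> x @ w \<in> cofinite_forest d r F"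
  by (auto simp: cofinite_forest_def dest: admissible_appendD)

lemma cof_deep:
  "F \<subseteq> {x. length x < n} \<Longrightarrow> x \<in> tree d r \<Longrightarrow> length x \<ge> n \<Longrightarrow> x \<in> cofinite_forest d r F"
  by (auto simp: cofinite_forest_def)

lemma admissible_level_bound:
  assumes "admissible d r F"
  obtains n where "F \<subseteq> {x. length x < n}"
proof -
  have "finite (length ` F)" using assms by (auto simp: admissible_def)
  then show ?thesis using that by (auto simp: finite_nat_set_iff_bounded)
qed

section \<open>Forest isomorphisms on the subtree below a vertex\<close>

text \<open>Along \<open>w\<close>, each further child goes to a child, so descendants of
  \<open>x\<close> keep their distance from it.\<close>

lemma iso_append:
  assumes "forest_iso (cofinite_forest d r F) Y \<psi>" "admissible d r F"
    and "x \<in> cofinite_forest d r F" "x @ w \<in> tree d r"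
  shows "\<exists>z. length z = length w \<and> \<psi> (x @ w) = \<psi> x @ z"
  using assms(4)
proof (induction w rule: rev_induct)
  case (snoc i w)
  have t: "x @ w \<in> tree d r" using snoc.prems tree_appendD[of "x @ w" "[i]"] by simp
  have "child (\<psi> (x @ w)) (\<psi> (x @ w @ [i]))"
    using assms(1) cof_append[OF assms(2,3) t] cof_append[OF assms(2,3) snoc.prems]
    unfolding forest_iso_iff by (metis append_assoc child_def)
  moreover obtain z where "length z = length w" "\<psi> (x @ w) = \<psi> x @ z"
    using snoc.IH t by blast
  ultimately obtain j where "\<psi> (x @ w @ [i]) = \<psi> x @ (z @ [j])" "length (z @ [j]) = length (w @ [i])"
    by (auto simp: child_def)
  then show ?case by blast
qed simp

text \<open>Splitting \<open>x\<close> at the cut and applying \<open>iso_append\<close> shows that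
  dropping the last \<open>k\<close> letters commutes with \<open>\<psi>\<close>. This is what
  allows a path to be truncated as a whole.\<close>

lemma iso_take:
  assumes "forest_iso (cofinite_forest d r F) Y \<psi>" "admissible d r F"
    and "take (length x - k) x \<in> cofinite_forest d r F" "x \<in> tree d r" "k \<le> length x"
  shows "k \<le> length (\<psi> x) \<and> \<psi> (take (length x - k) x) = take (length (\<psi> x) - k) (\<psi> x)"
proof -
  obtain z where "length z = k" "\<psi> x = \<psi> (take (length x - k) x) @ z"
    using iso_append[OF assms(1,2,3), of "drop (length x - k) x"] assms(4,5) by auto
  then show ?thesis by simp
qed

text \<open>\<open>iso_append\<close> also holds for the inverse isomorphism.\<close>

lemma iso_append_preimage:
  assumes iso: "forest_iso (cofinite_forest d r F) (cofinite_forest d r F') \<psi>"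
    and F': "admissible d r F'" and x: "x \<in> cofinite_forest d r F" and t: "\<psi> x @ z \<in> tree d r"
  obtains w where "x @ w \<in> cofinite_forest d r F" "\<psi> (x @ w) = \<psi> x @ z" "length w = length z"
proof -
  let ?X = "cofinite_forest d r F" and ?Y = "cofinite_forest d r F'"
  have bij: "bij_betw \<psi> ?X ?Y" using iso by (simp add: forest_iso_iff)
  have y: "\<psi> x \<in> ?Y" using bij x by (rule bij_betw_apply)
  have yz: "\<psi> x @ z \<in> ?Y" using cof_append[OF F' y t] .
  obtain w where w: "length w = length z"
    "inv_into ?X \<psi> (\<psi> x @ z) = inv_into ?X \<psi> (\<psi> x) @ w"
    using iso_append[OF forest_iso_inv[OF iso] F' y t] by blast
  have xw: "inv_into ?X \<psi> (\<psi> x @ z) = x @ w"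
    using w(2) bij x by (simp add: bij_betw_def)
  show ?thesis
  proof
    show "x @ w \<in> ?X" using xw bij yz by (metis bij_betw_def inv_into_into)
    show "\<psi> (x @ w) = \<psi> x @ z" using xw bij yz by (metis bij_betw_inv_into_right)
  qed (rule w(1))
qed

text \<open>The prefix of \<open>x\<close> of length \<open>n\<close> already avoids
  \<open>F\<close>, so the letters after it keep their number in the image.\<close>

lemma iso_level_bound:
  assumes "forest_iso (cofinite_forest d r F) Y \<psi>" "admissible d r F"
    and "F \<subseteq> {x. length x < n}" "x \<in> tree d r"
  shows "length x \<le> length (\<psi> x) + n"
proof (cases "length x \<le> n")
  case False
  then have "take (length x - (length x - n)) x \<in> cofinite_forest d r F"
    using assms(3,4) by (intro cof_deep[of F n]) (auto simp: tree_take)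
  from iso_take[OF assms(1,2) this assms(4)] show ?thesis by auto
qed simp

section \<open>Equivalent representatives and the exclusion of expansion\<close>

text \<open>A vertex has descendants arbitrarily deep, where equivalent representatives agree.\<close>

lemma rel_agree:
  assumes "d \<ge> 1" "r \<ge> 1" and rel: "((\<psi>, A, A'), (\<phi>, B, B')) \<in> aaut_rel d r"
    and x: "x \<in> cofinite_forest d r A" "x \<in> cofinite_forest d r B"
  shows "\<psi> x = \<phi> x"
proof -
  obtain G where G: "admissible d r G" "\<And>v. v \<in> cofinite_forest d r G \<Longrightarrow> \<psi> v = \<phi> v"
    and reps: "(\<psi>, A, A') \<in> aaut_reps d r" "(\<phi>, B, B') \<in> aaut_reps d r"
    using rel by (auto simp: rel_iff)
  obtain n where n: "G \<subseteq> {x. length x < n}" using admissible_level_bound[OF G(1)] .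
  let ?w = "replicate n 0"
  have t: "x @ ?w \<in> tree d r"
    using x tree_append_zeros[OF assms(1,2)] by (simp add: cofinite_forest_def)
  have "\<psi> (x @ ?w) = \<phi> (x @ ?w)" using G(2)[OF cof_deep[OF n t]] by simp
  \<comment> \<open>Both images prolong the values at \<open>x\<close> by exactly \<open>n\<close>
    letters; removing these brings the agreement back up to \<open>x\<close>.\<close>
  moreover obtain z where "length z = n" "\<psi> (x @ ?w) = \<psi> x @ z"
    using iso_append[OF repD(3,1)[OF reps(1)] x(1) t] by auto
  moreover obtain y where "length y = n" "\<phi> (x @ ?w) = \<phi> x @ y"
    using iso_append[OF repD(3,1)[OF reps(2)] x(2) t] by auto
  ultimately show ?thesis by simp
qed

text \<open>
  If \<open>\<phi>\<close> is defined at \<open>b\<close>, it moves the root of the component of \<open>b\<close> to a shorter prefix of \<open>b\<close>,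
  which is absurd. Otherwise replace \<open>b\<close> by \<open>b @ w\<close>, which is the image of a deeper vertex
  \<open>(b @ w) @ y\<close>.
\<close>

lemma automorphism_no_expansion:
  assumes dr: "d \<ge> 1" "r \<ge> 1" and rel: "((\<psi>, A, A'), (\<phi>, E, E)) \<in> aaut_rel d r"
    and "b @ w \<in> cofinite_forest d r A" "\<psi> (b @ w) = b"
  shows "w = []"
proof (rule ccontr)
  assume "w \<noteq> []"
  have reps: "(\<psi>, A, A') \<in> aaut_reps d r" "(\<phi>, E, E) \<in> aaut_reps d r"
    using rel by (auto simp: rel_iff)
  note \<phi> = repD[OF reps(2)] and \<psi> = repD[OF reps(1)]
  obtain n where n: "E \<subseteq> {x. length x < n}" using admissible_level_bound[OF \<phi>(1)] .
  show False using \<open>w \<noteq> []\<close> assms(4,5)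
  \<comment> \<open>The replacement of \<open>b\<close> by \<open>b @ w\<close> lowers this measure,
    since \<open>w\<close> is nonempty and vertices of \<open>E\<close> have level below
    \<open>n\<close>.\<close>
  proof (induction "n - length b" arbitrary: b w rule: less_induct)
    case less
    have t: "b @ w \<in> tree d r" "b \<in> tree d r"
      using less.prems tree_appendD by (auto simp: cofinite_forest_def)
    show ?case
    proof (cases "b \<in> cofinite_forest d r E")
      case True
      then have bw: "b @ w \<in> cofinite_forest d r E" using cof_append[OF \<phi>(1) _ t(1)] by blast
      have \<phi>b: "\<phi> (b @ w) = b" using rel_agree[OF dr rel less.prems(2) bw] less.prems(3) by simp
      define m where "m = (LEAST m. take m b \<in> cofinite_forest d r E)"
      have m: "take m b \<in> cofinite_forest d r E"
        unfolding m_def by (rule LeastI[of _ "length b"]) (simp add: True)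
      have "m \<le> length b" unfolding m_def by (rule Least_le) (simp add: True)
      then obtain z where z: "length z = length b - m + length w"
        "\<phi> (b @ w) = \<phi> (take m b) @ z"
        using iso_append[OF \<phi>(3,1) m, of "drop m b @ w"] t(1)
        by (auto simp flip: append_assoc)
      have "length b = length (\<phi> (take m b)) + (length b - m + length w)"
        using z \<phi>b by (metis length_append)
      then have "length (\<phi> (take m b)) < m"
        using length_greater_0_conv[of w] \<open>m \<le> length b\<close> less.prems(1) by linarith
      moreover have "\<phi> (take m b) = take (length (\<phi> (take m b))) b"
        using z(2) \<phi>b by (metis append_eq_conv_conj)
      then have "take (length (\<phi> (take m b))) b \<in> cofinite_forest d r E"
        using \<phi>(3) m unfolding forest_iso_iff by (metis bij_betw_apply)
      ultimately show False unfolding m_def using not_less_Least by blast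
    next
      case False
      then have b: "length b < n" using n t(2) by (auto simp: cofinite_forest_def)
      obtain y where "(b @ w) @ y \<in> cofinite_forest d r A" "\<psi> ((b @ w) @ y) = b @ w"
        "length y = length w"
        using iso_append_preimage[OF \<psi>(3,2) less.prems(2), of w] less.prems(3) t(1) by auto
      moreover have "n - length (b @ w) < n - length b"
        using b less.prems(1) by (intro diff_less_mono2) auto
      ultimately show False using less.hyps[of "b @ w" y] less.prems(1) by force
    qed
  qed
qed

lemma inv_class:
  assumes "(\<psi>, F, F') \<in> aaut_reps d r"
  shows "inv\<^bsub>neretin d r\<^esub> (aaut_rel d r `` {(\<psi>, F, F')})
    = aaut_rel d r `` {(inv_into (cofinite_forest d r F) \<psi>, F', F)}"
proof -
  let ?h = "inv_into (cofinite_forest d r F) \<psi>"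
  have F: "admissible d r F" using repD[OF assms] by auto
  have h: "(?h, F', F) \<in> aaut_reps d r" using rep_inv[OF assms] .
  have "inj_on \<psi> (cofinite_forest d r F)"
    using repD(3)[OF assms] by (simp add: forest_iso_iff bij_betw_def)
  then have "((?h \<circ> \<psi>, F, F), (id, F, F)) \<in> aaut_rel d r"
    using rep_comp[OF h assms] rep_id[OF F] F by (auto simp: rel_iff intro!: exI[of _ F])
  then have "aaut_rel d r `` {(?h \<circ> \<psi>, F, F)} = \<one>\<^bsub>neretin d r\<^esub>"
    using equiv_class_eq[OF equiv_rel] one_class[OF F] by simp
  then show ?thesis
    using mult_class[OF h assms] class_in_carrier[OF h] class_in_carrier[OF assms]
      group.inv_equality[OF neretin_group] by metis
qed

section \<open>Vertex maps realised by elements of H\<close>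

text \<open>Such a pair means that some element of \<open>H\<close> carries the subtree below
  \<open>x\<close> onto the one below \<open>y\<close>. Working with single vertices avoids tracking
  domains that shrink under composition.\<close>

definition induced_pair :: "nat \<Rightarrow> nat \<Rightarrow> aaut_rep set set \<Rightarrow> vertex \<Rightarrow> vertex \<Rightarrow> bool" where
  "induced_pair d r H x y \<longleftrightarrow> (\<exists>\<psi> A A'. (\<psi>, A, A') \<in> aaut_reps d r \<and>
     aaut_rel d r `` {(\<psi>, A, A')} \<in> H \<and> x \<in> cofinite_forest d r A \<and> \<psi> x = y)"

lemma induced_pair_refl:
  assumes "subgroup H (neretin d r)" "x \<in> tree d r"
  shows "induced_pair d r H x x"
  unfolding induced_pair_def
  using subgroup.one_closed[OF assms(1)] one_class[OF admissible_empty] rep_id[OF admissible_empty]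
    assms(2)
  by (intro exI[of _ id] exI[of _ "{}"]) (simp add: cofinite_forest_def)

lemma induced_pair_trans:
  assumes H: "subgroup H (neretin d r)" and "induced_pair d r H x y" "induced_pair d r H y z"
  shows "induced_pair d r H x z"
proof -
  obtain \<phi> A A' where \<phi>: "(\<phi>, A, A') \<in> aaut_reps d r" "aaut_rel d r `` {(\<phi>, A, A')} \<in> H"
    "x \<in> cofinite_forest d r A" "\<phi> x = y" using assms(2) by (auto simp: induced_pair_def)
  obtain \<psi> B B' where \<psi>: "(\<psi>, B, B') \<in> aaut_reps d r" "aaut_rel d r `` {(\<psi>, B, B')} \<in> H"
    "y \<in> cofinite_forest d r B" "\<psi> y = z" using assms(3) by (auto simp: induced_pair_def)
  have G: "admissible d r (A' \<union> B)" using \<phi> \<psi> by (auto intro: admissible_Un dest: repD)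
  obtain C where C: "A \<subseteq> C" "(\<phi>, C, A' \<union> B) \<in> aaut_reps d r"
    using rep_corestrict[OF \<phi>(1) G] by auto
  obtain C' where C': "(\<psi>, A' \<union> B, C') \<in> aaut_reps d r"
    using rep_restrict[OF \<psi>(1) G] by auto
  have inj: "inj_on \<phi> (cofinite_forest d r A)" and "y \<in> cofinite_forest d r A'"
    using repD(3)[OF \<phi>(1)] \<phi>(3,4) by (auto simp: forest_iso_iff bij_betw_def)
  then have "y \<in> cofinite_forest d r (A' \<union> B)" using \<psi>(3) by (auto simp: cofinite_forest_def)
  \<comment> \<open>The composite lives only outside \<open>C\<close>. The preimage of
    \<open>y\<close> there must be \<open>x\<close> by injectivity, so the composite is defined at
    \<open>x\<close>.\<close>
  then obtain x' where x': "x' \<in> cofinite_forest d r C" "\<phi> x' = y"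
    using repD(3)[OF C(2)] unfolding forest_iso_iff bij_betw_def by (metis imageE)
  then have "x = x'" using inj \<phi>(3,4) cof_mono[OF C(1)] by (metis inj_onD subsetD)
  have "aaut_rel d r `` {(\<psi> \<circ> \<phi>, C, C')} \<in> H"
    using subgroup.m_closed[OF H \<psi>(2) \<phi>(2)] rel_restrict[OF \<phi>(1) C(2)] rel_restrict[OF \<psi>(1) C']
      mult_class[OF C' C(2)] by simp
  then show ?thesis
    unfolding induced_pair_def using rep_comp[OF C' C(2)] x' \<open>x = x'\<close> \<psi>(4)
    by (intro exI[of _ "\<psi> \<circ> \<phi>"]) auto
qed

text \<open>This is where the assumption on the individual elements of \<open>H\<close>
  enters.\<close>

lemma induced_pair_no_expansion:
  assumes "d \<ge> 1" "r \<ge> 1" "subgroup H (neretin d r)"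
    and ell: "\<And>g. g \<in> H \<Longrightarrow> \<exists>F. admissible d r F \<and> induces_automorphism g F"
    and "induced_pair d r H (b @ w) b"
  shows "w = []"
proof -
  obtain \<psi> A A' where \<psi>: "(\<psi>, A, A') \<in> aaut_reps d r" "aaut_rel d r `` {(\<psi>, A, A')} \<in> H"
    "b @ w \<in> cofinite_forest d r A" "\<psi> (b @ w) = b" using assms(5) by (auto simp: induced_pair_def)
  obtain E \<phi> where "(\<phi>, E, E) \<in> aaut_rel d r `` {(\<psi>, A, A')}"
    using ell[OF \<psi>(2)] by (auto simp: induces_automorphism_def)
  then have "((\<psi>, A, A'), (\<phi>, E, E)) \<in> aaut_rel d r" by simp
  then show ?thesis using assms(1,2) \<psi>(3,4) automorphism_no_expansion by metis
qed

section \<open>Vertices from which F can be reached\<close>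

text \<open>
  \<open>W\<close> is a finite system of representatives of the generators and their inverses, all of them
  defined outside of \<open>F\<close>.
\<close>

definition step :: "nat \<Rightarrow> nat \<Rightarrow> aaut_rep set \<Rightarrow> vertex set \<Rightarrow> vertex \<Rightarrow> vertex \<Rightarrow> bool" where
  "step d r W F x y \<longleftrightarrow> x \<in> cofinite_forest d r F \<and> (\<exists>\<psi> A A'. (\<psi>, A, A') \<in> W \<and> y = \<psi> x)"

text \<open>This is the set called \<open>F'\<close> in the introductory remark; paths of length
  zero make it contain \<open>F\<close>.\<close>

definition absorbed :: "nat \<Rightarrow> nat \<Rightarrow> aaut_rep set \<Rightarrow> vertex set \<Rightarrow> vertex set" where
  "absorbed d r W F = {v \<in> tree d r. \<exists>f\<in>F. (step d r W F)\<^sup>*\<^sup>* v f}"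

locale common_domain =
  fixes d r :: nat and W :: "aaut_rep set" and F :: "vertex set"
  assumes adm: "admissible d r F"
    and reps: "W \<subseteq> aaut_reps d r"
    and dom: "(\<psi>, A, A') \<in> W \<Longrightarrow> A \<subseteq> F"
begin

lemma W_iso:
  assumes "(\<psi>, A, A') \<in> W"
  shows "admissible d r A" "forest_iso (cofinite_forest d r A) (cofinite_forest d r A') \<psi>"
    "cofinite_forest d r F \<subseteq> cofinite_forest d r A"
proof -
  have "(\<psi>, A, A') \<in> aaut_reps d r" using reps assms by blast
  then show "admissible d r A" "forest_iso (cofinite_forest d r A) (cofinite_forest d r A') \<psi>"
    by (auto dest: repD)
  show "cofinite_forest d r F \<subseteq> cofinite_forest d r A" using dom[OF assms] by (rule cof_mono)
qed

lemma step_tree: "step d r W F x y \<Longrightarrow> x \<in> tree d r \<and> y \<in> tree d r"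
  using W_iso by (fastforce simp: step_def forest_iso_iff bij_betw_def cofinite_forest_def)

text \<open>Lets the parents follow a path of their children while they stay outside
  \<open>F\<close>.\<close>

lemma step_child:
  assumes "step d r W F x y" "child u x" "u \<in> cofinite_forest d r F"
  shows "\<exists>v. child v y \<and> step d r W F u v"
proof -
  obtain \<psi> A A' where w: "x \<in> cofinite_forest d r F" "(\<psi>, A, A') \<in> W" "y = \<psi> x"
    using assms(1) by (auto simp: step_def)
  then have "child (\<psi> u) (\<psi> x)" using W_iso[OF w(2)] assms by (auto simp: forest_iso_iff)
  then show ?thesis using w assms(3) by (auto simp: step_def)
qed

lemma subset_absorbed: "F \<subseteq> absorbed d r W F"
  using adm by (auto simp: absorbed_def admissible_def)

text \<open>Read contrapositively, steps preserve the complement of the absorbed set.\<close>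

lemma absorbed_step: "step d r W F x y \<Longrightarrow> y \<in> absorbed d r W F \<Longrightarrow> x \<in> absorbed d r W F"
  unfolding absorbed_def by (blast dest: step_tree intro: converse_rtranclp_into_rtranclp)

text \<open>The parent is moved along the path of \<open>v\<close>: either it meets \<open>F\<close>
  on the way, or it ends as the parent of \<open>f\<close>, which is in \<open>F\<close> by
  admissibility.\<close>

lemma absorbed_parent:
  assumes "v \<in> absorbed d r W F" "child u v"
  shows "u \<in> absorbed d r W F"
proof -
  obtain f where f: "f \<in> F" "(step d r W F)\<^sup>*\<^sup>* v f" and v: "v \<in> tree d r"
    using assms by (auto simp: absorbed_def)
  from f(2) v assms(2) show ?thesis
  proof (induction arbitrary: u rule: converse_rtranclp_induct)
    case base
    then show ?case using f(1) adm admissible_parent subset_absorbed by blast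
  next
    case (step x y)
    show ?case
    proof (cases "u \<in> F")
      case False
      then have "u \<in> cofinite_forest d r F"
        using step.prems by (auto simp: cofinite_forest_def dest: parent_in_tree)
      then obtain v where v: "child v y" "step d r W F u v"
        using step_child[OF step.hyps(1) step.prems(2)] by blast
      then show ?thesis using step.IH step_tree[OF step.hyps(1)] absorbed_step by blast
    qed (use subset_absorbed in blast)
  qed
qed

lemma admissible_absorbed: "finite (absorbed d r W F) \<Longrightarrow> admissible d r (absorbed d r W F)"
  by (rule admissibleI) (auto intro: absorbed_parent, simp add: absorbed_def)

text \<open>Both \<open>\<psi>\<close> and its inverse map the complement of the absorbed set into
  itself, so \<open>\<psi>\<close> maps it onto itself.\<close>

lemma W_automorphism:
  assumes fin: "finite (absorbed d r W F)" and w: "(\<psi>, A, A') \<in> W"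
    and w': "(inv_into (cofinite_forest d r A) \<psi>, A', A) \<in> W"
  shows "(\<psi>, absorbed d r W F, absorbed d r W F) \<in> aaut_reps d r"
proof -
  let ?X = "cofinite_forest d r (absorbed d r W F)" and ?A = "cofinite_forest d r A"
  have XF: "?X \<subseteq> cofinite_forest d r F" using subset_absorbed by (rule cof_mono)
  have inv: "\<phi> x \<in> ?X" if "(\<phi>, B, B') \<in> W" "x \<in> ?X" for \<phi> B B' x
  proof -
    have "step d r W F x (\<phi> x)" using that XF by (auto simp: step_def)
    then show ?thesis
      using that(2) absorbed_step step_tree by (auto simp: cofinite_forest_def)
  qed
  have bij: "bij_betw \<psi> ?A (cofinite_forest d r A')" using W_iso[OF w] by (simp add: forest_iso_iff)
  have X: "?X \<subseteq> ?A" "?X \<subseteq> cofinite_forest d r A'" using XF W_iso(3)[OF w] W_iso(3)[OF w'] by auto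
  have "\<psi> ` ?X = ?X"
  proof
    show "?X \<subseteq> \<psi> ` ?X"
    proof
      fix y assume y: "y \<in> ?X"
      then have "y = \<psi> (inv_into ?A \<psi> y)" using bij X by (metis bij_betw_inv_into_right subsetD)
      then show "y \<in> \<psi> ` ?X" using inv[OF w' y] by blast
    qed
  qed (use inv[OF w] in blast)
  moreover have "inj_on \<psi> ?X" using bij X(1) by (auto simp: bij_betw_def intro: inj_on_subset)
  ultimately have "forest_iso ?X ?X \<psi>"
    using W_iso(2)[OF w] X(1) unfolding forest_iso_iff bij_betw_def by blast
  then show ?thesis using admissible_absorbed[OF fin] by (auto simp: aaut_reps_def)
qed

text \<open>After losing \<open>k\<close> letters the vertices still have level at least
  \<open>N\<close>, hence lie outside \<open>F\<close>. So \<open>iso_take\<close> applies to each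
  step, and transitivity composes the steps.\<close>

lemma path_truncation:
  assumes H: "subgroup H (neretin d r)" and W: "\<And>t. t \<in> W \<Longrightarrow> aaut_rel d r `` {t} \<in> H"
    and N: "F \<subseteq> {x. length x < N}"
    and path: "\<And>i. i < n \<Longrightarrow> step d r W F (v i) (v (Suc i))"
    and v: "v i \<in> tree d r" and ij: "i \<le> j" "j \<le> n"
    and len: "\<And>m. i \<le> m \<Longrightarrow> m \<le> j \<Longrightarrow> length (v m) \<ge> N + k"
  shows "induced_pair d r H (take (length (v i) - k) (v i)) (take (length (v j) - k) (v j))"
  using ij len
proof (induction j rule: dec_induct)
  case base
  then show ?case by (intro induced_pair_refl[OF H] tree_take v)
next
  case (step j)
  have ind: "induced_pair d r H (take (length (v i) - k) (v i)) (take (length (v j) - k) (v j))"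
    using step by simp
  have s: "step d r W F (v j) (v (Suc j))" using step.prems path by simp
  then obtain \<psi> A A' where w: "(\<psi>, A, A') \<in> W" "v (Suc j) = \<psi> (v j)" by (auto simp: step_def)
  have t: "v j \<in> tree d r" using step_tree[OF s] by blast
  have l: "N + k \<le> length (v j)" using step.prems step.hyps by simp
  have c: "take (length (v j) - k) (v j) \<in> cofinite_forest d r A"
    using l W_iso(3)[OF w(1)] by (intro subsetD[OF W_iso(3)[OF w(1)]] cof_deep[OF N] tree_take t) simp
  have "induced_pair d r H (take (length (v j) - k) (v j)) (take (length (v (Suc j)) - k) (v (Suc j)))"
    using iso_take[OF W_iso(2,1)[OF w(1)] c t] l w c W[OF w(1)] reps
    by (auto simp: induced_pair_def)
  then show ?case by (rule induced_pair_trans[OF H ind])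
qed

text \<open>
  On a path from a deep vertex down to \<open>F\<close>, stop at the last time before the level drops
  below \<open>N + k\<close> and cut off the last \<open>k\<close> letters of the vertex. The result has level in
  \<open>[N, 2 * N)\<close>, so two values of \<open>k\<close> give the same vertex \<open>b\<close>, and the part of the path
  between the two stopping times carries a proper descendant of \<open>b\<close> to \<open>b\<close>.
\<close>

lemma finite_absorbed:
  assumes dr: "d \<ge> 1" "r \<ge> 1" and H: "subgroup H (neretin d r)"
    and ell: "\<And>g. g \<in> H \<Longrightarrow> \<exists>F. admissible d r F \<and> induces_automorphism g F"
    and W: "\<And>t. t \<in> W \<Longrightarrow> aaut_rel d r `` {t} \<in> H"
  shows "finite (absorbed d r W F)"
proof -
  obtain N where N: "F \<subseteq> {x. length x < N}" using admissible_level_bound[OF adm] .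
  define B where "B = {x \<in> tree d r. length x < 2 * N}"
  have finB: "finite B" unfolding B_def by (rule finite_tree_level)
  \<comment> \<open>From a start at level at least \<open>N + card B\<close>, each of the
    \<open>card B + 1\<close> values \<open>k \<le> card B\<close> has a stopping time, one value
    more than \<open>B\<close> has elements.\<close>
  have "length x < N + card B" if x: "x \<in> absorbed d r W F" for x
  proof (rule ccontr)
    assume "\<not> ?thesis"
    then have deep: "length x \<ge> N + card B" by simp
    obtain f where f: "f \<in> F" "(step d r W F)\<^sup>*\<^sup>* x f" and xt: "x \<in> tree d r"
      using x by (auto simp: absorbed_def)
    obtain n where "((step d r W F) ^^ n) x f" using f(2) by (auto simp: rtranclp_power)
    then obtain v where v: "v 0 = x" "v n = f"
      and path: "\<And>i. i < n \<Longrightarrow> step d r W F (v i) (v (Suc i))"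
      by (auto simp: relpowp_fun_conv)
    have vt: "v i \<in> tree d r" if "i \<le> n" for i
    proof (cases i)
      case (Suc j)
      then show ?thesis using that step_tree[OF path[of j]] by simp
    qed (simp add: v(1) xt)
    have vn: "length (v n) < N" using f(1) N v(2) by blast
    \<comment> \<open>The \<open>Suc\<close> makes this the index just before the first drop; index
      0 itself is deep enough by the choice of \<open>x\<close>.\<close>
    define stop where "stop k = (LEAST i. length (v (Suc i)) < N + k)" for k
    have stop: "stop k < n" "length (v (Suc (stop k))) < N + k"
      "\<And>j. j \<le> stop k \<Longrightarrow> length (v j) \<ge> N + k" if k: "k \<le> card B" for k
    proof -
      have "n \<noteq> 0" using v deep vn by (cases n) auto
      then have n: "length (v (Suc (n - 1))) < N + k" using vn by simp
      show "length (v (Suc (stop k))) < N + k" unfolding stop_def using n by (rule LeastI)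
      have "stop k \<le> n - 1" unfolding stop_def using n by (rule Least_le)
      then show "stop k < n" using \<open>n \<noteq> 0\<close> by simp
      fix j assume j: "j \<le> stop k"
      show "length (v j) \<ge> N + k"
      proof (cases j)
        case 0
        then show ?thesis using v(1) deep k by simp
      next
        case (Suc i)
        then have "i < stop k" using j by simp
        then show ?thesis using not_less_Least[of i] Suc unfolding stop_def by fastforce
      qed
    qed
    define cut where "cut k = take (length (v (stop k)) - k) (v (stop k))" for k
    have "cut k \<in> B" if k: "k \<le> card B" for k
    proof -
      obtain \<psi> A A' where w: "(\<psi>, A, A') \<in> W" "v (Suc (stop k)) = \<psi> (v (stop k))"
        using path[OF stop(1)[OF k]] by (auto simp: step_def)
      \<comment> \<open>One step lowers the level by at most \<open>N\<close>, so the level at the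
        stopping time is below \<open>2 * N + k\<close>.\<close>
      have "length (v (stop k)) \<le> length (v (Suc (stop k))) + N"
        using iso_level_bound[OF W_iso(2,1)[OF w(1)], of N] dom[OF w(1)] N vt stop(1)[OF k] w(2)
        by auto
      then show ?thesis
        using stop(2)[OF k] vt[of "stop k"] stop(1)[OF k] vn by (auto simp: B_def cut_def tree_take)
    qed
    then have "cut ` {..card B} \<subseteq> B" by blast
    then have "card (cut ` {..card B}) \<le> card B" using finB by (rule card_mono[rotated])
    then have "\<not> inj_on cut {..card B}" by (auto dest!: card_image)
    then obtain k l where kl: "k \<le> card B" "l \<le> card B" "k < l" "cut k = cut l"
      by (metis (no_types, lifting) atMost_iff inj_on_def linorder_neqE_nat)
    \<comment> \<open>A level below \<open>N + k\<close> is also below \<open>N + l\<close>, so the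
      larger threshold is crossed no later.\<close>
    have le: "stop l \<le> stop k"
      unfolding stop_def[of l] by (rule Least_le) (use stop(2)[OF kl(1)] kl(3) in simp)
    have "induced_pair d r H (take (length (v (stop l)) - k) (v (stop l))) (cut k)"
      unfolding cut_def using stop[OF kl(1)] stop(1)[OF kl(2)] le
      by (intro path_truncation[where n = n, OF H W N]) (auto intro: vt path)
    \<comment> \<open>Cutting \<open>k\<close> instead of \<open>l\<close> letters at time
      \<open>stop l\<close> leaves a vertex \<open>l - k\<close> levels below \<open>cut l\<close>,
      which equals \<open>cut k\<close>.\<close>
    moreover have "take (length (v (stop l)) - k) (v (stop l))
        = cut l @ take (l - k) (drop (length (v (stop l)) - l) (v (stop l)))"
      unfolding cut_def take_add[symmetric] using kl(3) stop(3)[OF kl(2), of "stop l"] by simp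
    ultimately have "take (l - k) (drop (length (v (stop l)) - l) (v (stop l))) = []"
      using induced_pair_no_expansion[OF dr H ell] kl(4) by metis
    then show False using kl(3) stop(3)[OF kl(2), of "stop l"] by auto
  qed
  then show ?thesis
    by (intro finite_subset[OF _ finite_tree_level[of d r "N + card B"]]) (auto simp: absorbed_def)
qed

end

section \<open>From finiteness to a common cofinite forest\<close>

theorem theorem4p23:
  fixes d r :: nat and H :: "aaut_rep set set"
  assumes "d \<ge> 2" and "r \<ge> 1"
    and "subgroup H (neretin d r)"
    and "finitely_generated (neretin d r) H"
    and "\<And>g. g \<in> H \<Longrightarrow> \<exists>F. admissible d r F \<and> induces_automorphism g F"
  shows "\<exists>F. admissible d r F \<and> H \<subseteq> forest_automorphisms d r F"
proof -
  obtain S where S: "finite S" "S \<subseteq> H" "generate (neretin d r) S = H"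
    using assms(4) by (auto simp: finitely_generated_def)
  have carr: "H \<subseteq> carrier (neretin d r)" using assms(3) by (rule subgroup.subset)
  have "\<forall>s\<in>S. \<exists>t. t \<in> aaut_reps d r \<and> aaut_rel d r `` {t} = s"
    using S(2) carr by (blast elim: carrierE)
  from bchoice[OF this] obtain rep where rep: "\<And>s. s \<in> S \<Longrightarrow> rep s \<in> aaut_reps d r"
    "\<And>s. s \<in> S \<Longrightarrow> aaut_rel d r `` {rep s} = s" by blast
  define inv_rep :: "aaut_rep \<Rightarrow> aaut_rep" where
    "inv_rep = (\<lambda>(\<psi>, A, A'). (inv_into (cofinite_forest d r A) \<psi>, A', A))"
  \<comment> \<open>Both excluded sets are collected because inversion exchanges them.\<close>
  define F where "F = (\<Union>s\<in>S. fst (snd (rep s)) \<union> snd (snd (rep s)))"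
  define W where "W = rep ` S \<union> inv_rep ` rep ` S"
  have "admissible d r (fst (snd (rep s)) \<union> snd (snd (rep s)))" if "s \<in> S" for s
    using rep(1)[OF that] by (cases "rep s") (auto intro: admissible_Un dest: repD)
  then have adm: "admissible d r F"
    unfolding F_def using S(1) by (rule admissible_UN[rotated])
  interpret common_domain d r W F
  proof
    show "W \<subseteq> aaut_reps d r" using rep(1) by (auto simp: W_def inv_rep_def rep_inv split: prod.split)
    show "A \<subseteq> F" if t: "(\<psi>, A, A') \<in> W" for \<psi> A A'
    proof -
      obtain s where s: "s \<in> S" "(\<psi>, A, A') = rep s \<or> (\<psi>, A, A') = inv_rep (rep s)"
        using t unfolding W_def by blast
      then have "A \<subseteq> fst (snd (rep s)) \<union> snd (snd (rep s))"
        by (cases "rep s") (auto simp: inv_rep_def)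
      then show ?thesis using s(1) by (auto simp: F_def)
    qed
  qed (rule adm)
  have "aaut_rel d r `` {inv_rep (rep s)} \<in> H" if s: "s \<in> S" for s
  proof (cases "rep s")
    case (fields \<psi> A A')
    then show ?thesis
      using inv_class[of \<psi> A A' d r] rep[OF s] subgroup.m_inv_closed[OF assms(3), of s] s S(2)
      by (auto simp: inv_rep_def)
  qed
  then have WH: "aaut_rel d r `` {t} \<in> H" if "t \<in> W" for t
    using that rep(2) S(2) by (auto simp: W_def)
  let ?E = "absorbed d r W F"
  have fin: "finite ?E" using finite_absorbed[OF _ assms(2,3,5) WH] assms(1) by simp
  have E: "admissible d r ?E" using fin by (rule admissible_absorbed)
  \<comment> \<open>Restricting the chosen representative to the complement of \<open>?E\<close>
    does not change its class.\<close>
  have gen: "\<exists>\<psi>. (\<psi>, ?E, ?E) \<in> aaut_reps d r \<and> s = aaut_rel d r `` {(\<psi>, ?E, ?E)}" if s: "s \<in> S" for s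
  proof (cases "rep s")
    case (fields \<psi> A A')
    have "(\<psi>, A, A') \<in> W" "(inv_into (cofinite_forest d r A) \<psi>, A', A) \<in> W"
      using s fields by (auto simp: W_def inv_rep_def image_iff intro!: bexI[of _ s])
    then have "(\<psi>, ?E, ?E) \<in> aaut_reps d r" using W_automorphism[OF fin] by blast
    then show ?thesis using rep[OF s] fields rel_restrict by metis
  qed
  \<comment> \<open>Representatives on the same \<open>?E\<close> compose and invert without further
    restriction, so the property passes from the generators to all of \<open>H\<close>.\<close>
  have "\<exists>\<psi>. (\<psi>, ?E, ?E) \<in> aaut_reps d r \<and> h = aaut_rel d r `` {(\<psi>, ?E, ?E)}"
    if "h \<in> generate (neretin d r) S" for h
    using that
  proof induction
    case one
    then show ?case using one_class[OF E] rep_id[OF E] by blast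
  next
    case (incl h)
    then show ?case by (rule gen)
  next
    case (inv h)
    then obtain \<psi> where \<psi>: "(\<psi>, ?E, ?E) \<in> aaut_reps d r"
      "h = aaut_rel d r `` {(\<psi>, ?E, ?E)}" using gen by blast
    show ?case unfolding \<psi>(2) inv_class[OF \<psi>(1)] using rep_inv[OF \<psi>(1)] by blast
  next
    case (eng h k)
    then obtain \<psi> \<phi> where \<psi>: "(\<psi>, ?E, ?E) \<in> aaut_reps d r"
        "h = aaut_rel d r `` {(\<psi>, ?E, ?E)}"
      and \<phi>: "(\<phi>, ?E, ?E) \<in> aaut_reps d r" "k = aaut_rel d r `` {(\<phi>, ?E, ?E)}" by blast
    show ?case
      unfolding \<psi>(2) \<phi>(2) mult_class[OF \<psi>(1) \<phi>(1)] using rep_comp[OF \<psi>(1) \<phi>(1)] by blast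
  qed
  then have "H \<subseteq> forest_automorphisms d r ?E"
    unfolding S(3) forest_automorphisms_def induces_automorphism_def
    using equiv_class_self[OF equiv_rel] class_in_carrier by blast
  with E show ?thesis by blast
qed

end
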